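(* Let $I\subset R=\Bbbk[x_0,\ldots,x_n]$ be a nonzero proper monomial ideal and let $\mathcal{Q}\subseteq\mathbb{R}^{n+1}$ be its symbolic polyhedron. Then $\mathcal{L}(I^{(m)})\subset m\mathcal{Q}$ for all integers $m\ge 1$.
   Context: $\Bbbk$ is a field. $\operatorname{Ass}(I)$ is the set of associated primes of $I$ (of $R/I$), and $\operatorname{maxAss}(I)$ is the subset of those maximal with respect to inclusion. The $m$-th symbolic power is $I^{(m)} = R\cap\bigcap_{P\in \operatorname{Ass}(I)} I^m R_P$. For $P\in\operatorname{maxAss}(I)$ put $Q_{\subseteq P}=R\cap I R_P$, a monomial ideal. For a monomial ideal $M$, $\mathcal{L}(M)=\{\mathbf{a}\in\mathbb{N}^{n+1}\mid \mathbf{x}^{\mathbf{a}}\in M\}$, where $\mathbb{N}$ is the set of non-negative integers and $\mathbf{x}^{\mathbf a}=x_0^{a_0}\cdots x_n^{a_n}$. The symbolic polyhedron of $I$ is $\mathcal{Q}=\bigcap_{P\in\operatorname{maxAss}(I)}\operatorname{conv}(\mathcal{L}(Q_{\subseteq P}))\subseteq\mathbb{R}^{n+1}$ ($\operatorname{conv}$ denotes convex hull), and $m\mathcal{Q}=\{m\mathbf a\mid \mathbf a\in\mathcal{Q}\}$. The inclusion symbol $\subset$ does not require strictness. *)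

theory Defs
  imports
    "HOL-Analysis.Analysis"
    "HOL-Library.Poly_Mapping"
    "HOL-Computational_Algebra.Polynomial_Factorial"
begin

text \<open>
  The variables \<open>x\<^sub>0, \<dots>, x\<^sub>n\<close> are indexed by a type \<open>'v\<close> of class \<open>{finite, linorder}\<close>
  with \<open>n + 1\<close> elements.  The linear order on the indices enters only through the class
  instance making the polynomial ring an integral domain, hence giving it a fraction field.
\<close>

type_synonym 'v expo = "'v \<Rightarrow>\<^sub>0 nat"

type_synonym ('v, 'k) mpoly_ring = "'v expo \<Rightarrow>\<^sub>0 'k"

definition xpow :: "'v expo \<Rightarrow> ('v, 'k::field) mpoly_ring" where
  "xpow a = Poly_Mapping.single a 1"

text \<open>An ideal is a submodule of the ring over itself.\<close>

lemma module_mult: "module ((*) :: 'a::comm_ring_1 \<Rightarrow> 'a \<Rightarrow> 'a)"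
  by unfold_locales (simp_all add: algebra_simps)

definition is_ideal :: "'a::comm_ring_1 set \<Rightarrow> bool" where
  "is_ideal I \<longleftrightarrow> module.subspace (*) I"

definition ideal_gen :: "'a::comm_ring_1 set \<Rightarrow> 'a set" where
  "ideal_gen S = module.span (*) S"

definition ideal_pow :: "'a::comm_ring_1 set \<Rightarrow> nat \<Rightarrow> 'a set" where
  "ideal_pow I m = ideal_gen {\<Prod>j<m. f j | f. \<forall>j<m. f j \<in> I}"

definition prime_ideal :: "'a::comm_ring_1 set \<Rightarrow> bool" where
  "prime_ideal P \<longleftrightarrow> is_ideal P \<and> P \<noteq> UNIV \<and> (\<forall>a b. a * b \<in> P \<longrightarrow> a \<in> P \<or> b \<in> P)"

definition monomial_ideal :: "('v::{finite,linorder}, 'k::field) mpoly_ring set \<Rightarrow> bool" where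
  "monomial_ideal I \<longleftrightarrow> (\<exists>A. I = ideal_gen (xpow ` A))"

text \<open>\<open>{r. r * f \<in> I}\<close> is the annihilator of the residue class of \<open>f\<close> in \<open>R/I\<close>.\<close>

definition Ass :: "'a::comm_ring_1 set \<Rightarrow> 'a set set" where
  "Ass I = {P. prime_ideal P \<and> (\<exists>f. P = {r. r * f \<in> I})}"

definition maxAss :: "'a::comm_ring_1 set \<Rightarrow> 'a set set" where
  "maxAss I = {P \<in> Ass I. \<not> (\<exists>P' \<in> Ass I. P \<subset> P')}"

text \<open>For a prime \<open>P\<close> of a domain \<open>R\<close>, the localization \<open>R\<^sub>P\<close> is taken inside the fraction
  field, so that the intersection of \<open>R\<close> with ideals of various \<open>R\<^sub>P\<close> takes place there.\<close>

definition loc :: "'a::idom set \<Rightarrow> 'a fract set" where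
  "loc P = {Fract f s | f s. s \<notin> P}"

text \<open>\<open>loc_ext J P\<close> is \<open>J R\<^sub>P\<close>, the ideal of \<open>R\<^sub>P\<close> generated by \<open>J\<close>.\<close>

definition loc_ext :: "'a::idom set \<Rightarrow> 'a set \<Rightarrow> 'a fract set" where
  "loc_ext J P = {\<Sum>j<k. r j * to_fract (g j) | (k::nat) r g. \<forall>j<k. r j \<in> loc P \<and> g j \<in> J}"

definition symb_pow :: "'a::idom set \<Rightarrow> nat \<Rightarrow> 'a set" where
  "symb_pow I m = {f. to_fract f \<in> (\<Inter>P\<in>Ass I. loc_ext (ideal_pow I m) P)}"

definition Q_sub :: "'a::idom set \<Rightarrow> 'a set \<Rightarrow> 'a set" where
  "Q_sub I P = {f. to_fract f \<in> loc_ext I P}"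

definition expo_set :: "('v::{finite,linorder}, 'k::field) mpoly_ring set \<Rightarrow> 'v expo set" where
  "expo_set M = {a. xpow a \<in> M}"

text \<open>The inclusion of the lattice points with nonnegative coordinates into \<open>\<real>\<^sup>n\<^sup>+\<^sup>1\<close>.\<close>

definition real_expo :: "'v::finite expo \<Rightarrow> real ^ 'v" where
  "real_expo a = (\<chi> i. real (Poly_Mapping.lookup a i))"

definition symb_polyhedron ::
    "('v::{finite,linorder}, 'k::field) mpoly_ring set \<Rightarrow> (real ^ ('v::{finite,linorder})) set" where
  "symb_polyhedron I = (\<Inter>P\<in>maxAss I. convex hull (real_expo ` expo_set (Q_sub I P)))"

end

theory Submission
  imports Defs
begin

text \<open>
  If \<open>x\<^sup>a \<in> I\<^sup>m R\<^sub>P\<close>, then \<open>s x\<^sup>a \<in> I\<^sup>m\<close> for some \<open>s \<notin> P\<close>, and since \<open>I\<^sup>m\<close> is monomial, \<open>s\<close> may be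
  replaced by one of its monomials \<open>x\<^sup>t \<notin> P\<close>.  So \<open>t + a \<ge> b\<^sub>1 + \<dots> + b\<^sub>m\<close> with all \<open>b\<^sub>j \<in> \<L>(I)\<close>.  Truncating
  each \<open>b\<^sub>j\<close> to \<open>0\<close> on the support of \<open>t\<close> gives exponents of monomials in \<open>Q\<^sub>\<subseteq>\<^sub>P\<close> whose sum is at
  most \<open>a\<close>.  Hence \<open>a\<close> is a sum of \<open>m\<close> elements of \<open>\<L>(Q\<^sub>\<subseteq>\<^sub>P)\<close>, and \<open>a / m\<close> is their average.
\<close>

section \<open>Ideals and the complement of a prime\<close>

lemma ideal_gen_is_ideal: "is_ideal (ideal_gen S)"
  unfolding is_ideal_def ideal_gen_def
  by (rule module.subspace_span[OF module_mult])

lemma ideal_gen_base: "x \<in> S \<Longrightarrow> x \<in> ideal_gen S"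
  unfolding ideal_gen_def by (rule module.span_base[OF module_mult])

lemma is_ideal_0: "is_ideal J \<Longrightarrow> 0 \<in> J"
  unfolding is_ideal_def by (rule module.subspace_0[OF module_mult])

lemma is_ideal_add: "is_ideal J \<Longrightarrow> x \<in> J \<Longrightarrow> y \<in> J \<Longrightarrow> x + y \<in> J"
  unfolding is_ideal_def by (rule module.subspace_add[OF module_mult])

lemma is_ideal_mult: "is_ideal J \<Longrightarrow> x \<in> J \<Longrightarrow> r * x \<in> J"
  unfolding is_ideal_def by (rule module.subspace_scale[OF module_mult])

lemma is_ideal_sum: "is_ideal J \<Longrightarrow> (\<And>x. x \<in> A \<Longrightarrow> f x \<in> J) \<Longrightarrow> sum f A \<in> J"
  unfolding is_ideal_def by (rule module.subspace_sum[OF module_mult])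

lemma prime_ideal_1: "prime_ideal P \<Longrightarrow> 1 \<notin> P"
  unfolding prime_ideal_def using is_ideal_mult[of P 1] by force

lemma prime_ideal_mult: "prime_ideal P \<Longrightarrow> s \<notin> P \<Longrightarrow> t \<notin> P \<Longrightarrow> s * t \<notin> P"
  unfolding prime_ideal_def by blast

lemma prime_ideal_power: "prime_ideal P \<Longrightarrow> s \<notin> P \<Longrightarrow> s ^ n \<notin> P"
  by (induction n) (simp_all add: prime_ideal_1 prime_ideal_mult)

lemma prime_ideal_0: "prime_ideal P \<Longrightarrow> 0 \<in> P"
  unfolding prime_ideal_def using is_ideal_0 by blast

text \<open>Forward, clear denominators: finitely many denominators outside \<open>P\<close> have
  their product outside \<open>P\<close>, because \<open>P\<close> is prime. Backward,
  \<open>f\<close> is \<open>1/s\<close> times \<open>s * f\<close>. This turns every later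
  statement about fractions into one about polynomials.\<close>

lemma to_fract_mem_loc_ext_iff:
  assumes P: "prime_ideal P" and J: "is_ideal J"
  shows "to_fract f \<in> loc_ext J P \<longleftrightarrow> (\<exists>s. s \<notin> P \<and> s * f \<in> J)"
proof
  assume "to_fract f \<in> loc_ext J P"
  then obtain k :: nat and r g where f: "to_fract f = (\<Sum>j<k. r j * to_fract (g j))"
    and rg: "\<forall>j<k. r j \<in> loc P \<and> g j \<in> J"
    unfolding loc_ext_def by blast
  \<comment> \<open>Induction on the number of summands merges the sum into one fraction with
    numerator in \<open>J\<close> and denominator outside \<open>P\<close>.\<close>
  from rg have "\<exists>h s. s \<notin> P \<and> h \<in> J \<and> (\<Sum>j<k. r j * to_fract (g j)) = Fract h s"
  proof (induction k)
    case 0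
    show ?case
      using prime_ideal_1[OF P] is_ideal_0[OF J] by (auto simp: Zero_fract_def)
  next
    case (Suc k)
    then obtain h s where hs: "s \<notin> P" "h \<in> J" "(\<Sum>j<k. r j * to_fract (g j)) = Fract h s"
      by auto
    from Suc.prems obtain u v where uv: "r k = Fract u v" "v \<notin> P" and g: "g k \<in> J"
      unfolding loc_def by blast
    \<comment> \<open>Denominators outside \<open>P\<close> are nonzero since \<open>P\<close>
      contains 0. This has to be known because \<open>Fract u 0\<close> is 0 by convention.\<close>
    have nz: "s \<noteq> 0" "v \<noteq> 0"
      using hs(1) uv(2) prime_ideal_0[OF P] by auto
    have "(\<Sum>j<Suc k. r j * to_fract (g j)) = Fract (v * h + (s * u) * g k) (s * v)"
      using nz hs(3) uv(1) by (simp add: to_fract_def algebra_simps)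
    moreover have "v * h + (s * u) * g k \<in> J"
      by (intro is_ideal_add[OF J] is_ideal_mult[OF J] hs g)
    ultimately show ?case
      using prime_ideal_mult[OF P hs(1) uv(2)] by blast
  qed
  then obtain h s where hs: "s \<notin> P" "h \<in> J" "to_fract f = Fract h s"
    using f by auto
  moreover have "s \<noteq> 0"
    using hs(1) prime_ideal_0[OF P] by auto
  ultimately have "s * f = h"
    by (simp add: to_fract_def eq_fract mult.commute)
  then show "\<exists>s. s \<notin> P \<and> s * f \<in> J"
    using hs by blast
next
  assume "\<exists>s. s \<notin> P \<and> s * f \<in> J"
  then obtain s where s: "s \<notin> P" "s * f \<in> J"
    by blast
  have "s \<noteq> 0"
    using s(1) prime_ideal_0[OF P] by auto
  then have "to_fract f = (\<Sum>j<1::nat. Fract 1 s * to_fract (s * f))"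
    by (simp add: to_fract_def eq_fract)
  moreover have "Fract 1 s \<in> loc P"
    using s(1) unfolding loc_def by blast
  ultimately show "to_fract f \<in> loc_ext J P"
    unfolding loc_ext_def using s(2)
    by (intro CollectI exI[of _ "1::nat"] exI[of _ "\<lambda>_. Fract 1 s"] exI[of _ "\<lambda>_. s * f"]) simp
qed

section \<open>Monomials and supports of polynomials in monomial ideals\<close>

lemma xpow_add: "xpow (a + b) = xpow a * xpow b"
  by (simp add: xpow_def mult_single)

lemma xpow_sum_const: "xpow (\<Sum>j<n. t) = xpow t ^ n"
proof (induction n)
  case 0
  show ?case by (simp add: xpow_def)
next
  case (Suc n)
  then show ?case by (simp add: xpow_add mult.commute)
qed

lemma poly_sum_xpow: "f = (\<Sum>k\<in>Poly_Mapping.keys f. Poly_Mapping.single 0 (Poly_Mapping.lookup f k) * xpow k)"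
  by (rule poly_mapping_eqI)
    (auto simp: xpow_def mult_single lookup_sum lookup_single when_def in_keys_iff sum.delta)

text \<open>Were all monomials of \<open>s\<close> in \<open>P\<close>, their combination
  \<open>s\<close> would be too.\<close>

lemma ideal_nonmember_monomial:
  assumes "is_ideal P" and "s \<notin> P"
  obtains t where "t \<in> Poly_Mapping.keys s" and "xpow t \<notin> P"
proof -
  have "\<exists>t\<in>Poly_Mapping.keys s. xpow t \<notin> P"
  proof (rule ccontr)
    assume "\<not> ?thesis"
    then have "(\<Sum>k\<in>Poly_Mapping.keys s. Poly_Mapping.single 0 (Poly_Mapping.lookup s k) * xpow k) \<in> P"
      by (intro is_ideal_sum is_ideal_mult assms(1)) auto
    then show False
      using assms(2) poly_sum_xpow[of s] by simp
  qed
  then show thesis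
    using that by blast
qed

text \<open>Multiplication by a monomial translates the support injectively, so no terms
  cancel.\<close>

lemma keys_mult_xpow:
  assumes "t \<in> Poly_Mapping.keys s"
  shows "t + a \<in> Poly_Mapping.keys (s * xpow a)"
proof -
  have "s * xpow a = (\<Sum>k\<in>Poly_Mapping.keys s. Poly_Mapping.single (k + a) (Poly_Mapping.lookup s k))"
    by (subst poly_sum_xpow[of s]) (simp add: sum_distrib_right xpow_def mult_single)
  then have "Poly_Mapping.lookup (s * xpow a) (t + a) = Poly_Mapping.lookup s t"
    using assms by (simp add: lookup_sum lookup_single when_def sum.delta)
  then show ?thesis
    using assms by (simp add: in_keys_iff)
qed

text \<open>For an upward closed \<open>E\<close>, the polynomials supported in \<open>E\<close>
  form an ideal, which contains the span of \<open>S\<close> once it contains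
  \<open>S\<close>.\<close>

lemma keys_ideal_gen:
  fixes S :: "('v::{finite,linorder}, 'k::field) mpoly_ring set"
  assumes S: "\<And>s. s \<in> S \<Longrightarrow> Poly_Mapping.keys s \<subseteq> E"
    and E: "\<And>e c. e \<in> E \<Longrightarrow> e + c \<in> E"
    and f: "f \<in> ideal_gen S"
  shows "Poly_Mapping.keys f \<subseteq> E"
proof -
  have "module.subspace (*) {f :: ('v, 'k) mpoly_ring. Poly_Mapping.keys f \<subseteq> E}"
  proof (rule module.subspaceI[OF module_mult])
    fix x y c :: "('v, 'k) mpoly_ring"
    assume x: "x \<in> {f. Poly_Mapping.keys f \<subseteq> E}"
    show "c * x \<in> {f. Poly_Mapping.keys f \<subseteq> E}"
    proof (intro CollectI subsetI)
      fix k
      assume "k \<in> Poly_Mapping.keys (c * x)"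
      then obtain p q where k: "k = p + q" and "q \<in> Poly_Mapping.keys x"
        using keys_mult[of c x] by blast
      then have "q \<in> E"
        using x by blast
      then show "k \<in> E"
        unfolding k using E[of q p] by (simp only: add.commute)
    qed
    assume "y \<in> {f. Poly_Mapping.keys f \<subseteq> E}"
    then show "x + y \<in> {f. Poly_Mapping.keys f \<subseteq> E}"
      using x keys_add[of x y] by blast
  qed simp
  moreover have "S \<subseteq> {f. Poly_Mapping.keys f \<subseteq> E}"
    using S by blast
  ultimately have "ideal_gen S \<subseteq> {f. Poly_Mapping.keys f \<subseteq> E}"
    unfolding ideal_gen_def by (intro module.span_minimal[OF module_mult])
  then show ?thesis
    using f by blast
qed

text \<open>Since exponents are natural numbers, the sums \<open>b + c\<close> with \<open>b\<close>
  in \<open>A\<close> form the upward closure of \<open>A\<close>, to which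
  \<open>keys_ideal_gen\<close> applies.\<close>

lemma keys_ideal_gen_xpow:
  fixes f :: "('v::{finite,linorder}, 'k::field) mpoly_ring"
  assumes "f \<in> ideal_gen (xpow ` A)"
  shows "Poly_Mapping.keys f \<subseteq> {b + c | b c. b \<in> A}"
proof (rule keys_ideal_gen[OF _ _ assms])
  show "Poly_Mapping.keys s \<subseteq> {b + c | b c. b \<in> A}" if "s \<in> xpow ` A" for s :: "('v, 'k) mpoly_ring"
  proof -
    obtain b where b: "b \<in> A" "s = xpow b"
      using \<open>s \<in> xpow ` A\<close> by blast
    have "b = b + 0"
      by simp
    with b(1) have "b \<in> {b + c | b c. b \<in> A}"
      by blast
    then show ?thesis
      unfolding b(2) xpow_def by simp
  qed
  show "e + c \<in> {b + c | b c. b \<in> A}" if "e \<in> {b + c | b c. b \<in> A}" for e c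
  proof -
    obtain b c' where "e + c = b + (c' + c)" and "b \<in> A"
      using \<open>e \<in> {b + c | b c. b \<in> A}\<close> by (auto simp: add.assoc)
    then show ?thesis
      by blast
  qed
qed

text \<open>The factors are arbitrary polynomials, as in the generators of \<open>ideal_pow\<close>.
  Supports add under multiplication, and the excesses of the factors collect in one
  \<open>c\<close>.\<close>

lemma keys_prod:
  fixes f :: "nat \<Rightarrow> ('v::{finite,linorder}, 'k::field) mpoly_ring"
  assumes "\<And>j. j < m \<Longrightarrow> Poly_Mapping.keys (f j) \<subseteq> {b + c | b c. b \<in> A}"
  shows "Poly_Mapping.keys (\<Prod>j<m. f j) \<subseteq> {(\<Sum>j<m. b j) + c | b c. \<forall>j<m. b j \<in> A}"
  using assms
proof (induction m)
  case 0
  show ?case by auto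
next
  case (Suc m)
  show ?case
  proof
    fix k
    assume "k \<in> Poly_Mapping.keys (\<Prod>j<Suc m. f j)"
    then obtain p q where k: "k = p + q"
      and p: "p \<in> Poly_Mapping.keys (\<Prod>j<m. f j)" and q: "q \<in> Poly_Mapping.keys (f m)"
      using keys_mult[of "\<Prod>j<m. f j" "f m"] by auto
    have "Poly_Mapping.keys (\<Prod>j<m. f j) \<subseteq> {(\<Sum>j<m. b j) + c | b c. \<forall>j<m. b j \<in> A}"
      by (rule Suc.IH, rule Suc.prems) simp
    with p obtain b c where b: "p = (\<Sum>j<m. b j) + c" "\<forall>j<m. b j \<in> A"
      by blast
    from q Suc.prems[of m] obtain b' c' where b': "q = b' + c'" "b' \<in> A"
      by auto
    have "k = (\<Sum>j<Suc m. (b(m := b')) j) + (c + c')"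
      using k b b' by (simp add: algebra_simps)
    moreover have "\<forall>j<Suc m. (b(m := b')) j \<in> A"
      using b b' by auto
    ultimately show "k \<in> {(\<Sum>j<Suc m. b j) + c | b c. \<forall>j<Suc m. b j \<in> A}"
      by blast
  qed
qed

lemma keys_ideal_pow:
  fixes f :: "('v::{finite,linorder}, 'k::field) mpoly_ring"
  assumes "f \<in> ideal_pow (ideal_gen (xpow ` A)) m"
  shows "Poly_Mapping.keys f \<subseteq> {(\<Sum>j<m. b j) + c | b c. \<forall>j<m. b j \<in> A}"
proof (rule keys_ideal_gen[OF _ _ assms[unfolded ideal_pow_def]])
  fix s :: "('v, 'k) mpoly_ring"
  assume "s \<in> {\<Prod>j<m. f j | f. \<forall>j<m. f j \<in> ideal_gen (xpow ` A)}"
  then obtain f where "s = (\<Prod>j<m. f j)" and "\<forall>j<m. f j \<in> ideal_gen (xpow ` A)"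
    by blast
  then show "Poly_Mapping.keys s \<subseteq> {(\<Sum>j<m. b j) + c | b c. \<forall>j<m. b j \<in> A}"
    by (simp only:) (intro keys_prod keys_ideal_gen_xpow, blast)
next
  fix e c
  assume "e \<in> {(\<Sum>j<m. b j) + c | b c. \<forall>j<m. b j \<in> A}"
  then obtain b c' where "e + c = (\<Sum>j<m. b j) + (c' + c)" and "\<forall>j<m. b j \<in> A"
    by (auto simp: add.assoc)
  then show "e + c \<in> {(\<Sum>j<m. b j) + c | b c. \<forall>j<m. b j \<in> A}"
    by blast
qed

section \<open>Localization at a prime in terms of exponents\<close>

lemma monomial_localization:
  fixes a :: "'v::{finite,linorder} expo" and P :: "('v, 'k::field) mpoly_ring set"
  assumes P: "prime_ideal P"
    and a: "to_fract (xpow a) \<in> loc_ext (ideal_pow (ideal_gen (xpow ` A)) m) P"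
  obtains t b c where "xpow t \<notin> P" and "\<forall>j<m. b j \<in> A" and "t + a = (\<Sum>j<m. b j) + c"
proof -
  have "is_ideal (ideal_pow (ideal_gen (xpow ` A)) m :: ('v, 'k) mpoly_ring set)"
    unfolding ideal_pow_def by (rule ideal_gen_is_ideal)
  then obtain s where s: "s \<notin> P" "s * xpow a \<in> ideal_pow (ideal_gen (xpow ` A)) m"
    using a to_fract_mem_loc_ext_iff[OF P] by blast
  obtain t where t: "t \<in> Poly_Mapping.keys s" "xpow t \<notin> P"
    using P s(1) ideal_nonmember_monomial unfolding prime_ideal_def by blast
  then have "t + a \<in> {(\<Sum>j<m. b j) + c | b c. \<forall>j<m. b j \<in> A}"
    using keys_mult_xpow keys_ideal_pow[OF s(2)] by blast
  then show thesis
    using that t(2) by blast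
qed

text \<open>The monomial of exponent \<open>n\<close> times \<open>t\<close> stays outside the prime
  \<open>P\<close>, and multiplying by it restores an exponent \<ge> \<open>b\<close>. The free
  summand \<open>c\<close> later absorbs an excess.\<close>

lemma expo_set_Q_sub:
  fixes I :: "('v::{finite,linorder}, 'k::field) mpoly_ring set"
  assumes P: "prime_ideal P" and I: "is_ideal I"
    and b: "xpow b \<in> I" and t: "xpow t \<notin> P"
  shows "b - (\<Sum>j<n::nat. t) + c \<in> expo_set (Q_sub I P)"
proof -
  let ?T = "\<Sum>j<n. t"
  have "?T + (b - ?T + c) = (?T + (b - ?T) - b + c) + b"
    by (rule poly_mapping_eqI) (simp add: lookup_add lookup_minus)
  then have "xpow ?T * xpow (b - ?T + c) = xpow (?T + (b - ?T) - b + c) * (xpow b :: ('v, 'k) mpoly_ring)"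
    by (metis xpow_add)
  then have "xpow ?T * xpow (b - ?T + c) \<in> I"
    using is_ideal_mult[OF I b] by simp
  moreover have "xpow ?T \<notin> P"
    unfolding xpow_sum_const by (rule prime_ideal_power[OF P t])
  ultimately show ?thesis
    unfolding expo_set_def Q_sub_def using to_fract_mem_loc_ext_iff[OF P I] by blast
qed

lemma expo_decomposition:
  fixes a :: "'v::{finite,linorder} expo" and P :: "('v, 'k::field) mpoly_ring set"
  assumes P: "prime_ideal P" and m: "m \<ge> 1"
    and a: "to_fract (xpow a) \<in> loc_ext (ideal_pow (ideal_gen (xpow ` A)) m) P"
  obtains b where "a = (\<Sum>j<m. b j)"
    and "\<forall>j<m. b j \<in> expo_set (Q_sub (ideal_gen (xpow ` A)) P)"
proof -
  obtain t b c where t: "xpow t \<notin> P" and b: "\<forall>j<m. b j \<in> A" and tab: "t + a = (\<Sum>j<m. b j) + c"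
    using monomial_localization[OF P a] by metis
  \<comment> \<open>Large enough for subtracting \<open>n t\<close> to annihilate every \<open>b j\<close> on the support of \<open>t\<close>.\<close>
  define n where "n = (\<Sum>j<m. \<Sum>i\<in>UNIV. Poly_Mapping.lookup (b j) i)"
  define b' where "b' j = b j - (\<Sum>j<n. t)" for j
  define d where "d = a - (\<Sum>j<m. b' j)"
  \<comment> \<open>Off the support of \<open>t\<close>, compare coordinates in \<open>tab\<close>;
    truncation only lowers the left side. On the support, all \<open>b' j\<close> vanish by the
    choice of \<open>n\<close>.\<close>
  have le: "(\<Sum>j<m. Poly_Mapping.lookup (b' j) i) \<le> Poly_Mapping.lookup a i" for i
  proof (cases "Poly_Mapping.lookup t i = 0")
    case True
    have "Poly_Mapping.lookup (t + a) i = Poly_Mapping.lookup ((\<Sum>j<m. b j) + c) i"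
      by (simp only: tab)
    moreover have "(\<Sum>j<m. Poly_Mapping.lookup (b' j) i) \<le> (\<Sum>j<m. Poly_Mapping.lookup (b j) i)"
      by (intro sum_mono) (simp add: b'_def lookup_minus)
    ultimately show ?thesis
      using True by (simp add: lookup_add lookup_sum)
  next
    case False
    have "Poly_Mapping.lookup (b' j) i = 0" if "j < m" for j
    proof -
      have "Poly_Mapping.lookup (b j) i \<le> (\<Sum>i\<in>UNIV. Poly_Mapping.lookup (b j) i)"
        by (rule member_le_sum) auto
      also have "\<dots> \<le> n"
        unfolding n_def using that by (intro member_le_sum) auto
      also have "\<dots> \<le> n * Poly_Mapping.lookup t i"
        using False by simp
      finally show ?thesis
        by (simp add: b'_def lookup_minus lookup_sum)
    qed
    then show ?thesis by simp
  qed
  \<comment> \<open>By \<open>le\<close>, nothing is truncated in the subtraction defining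
    \<open>d\<close>.\<close>
  have "a = (\<Sum>j<m. b' j) + d"
    using le by (intro poly_mapping_eqI) (simp add: d_def lookup_add lookup_minus lookup_sum)
  \<comment> \<open>The excess \<open>d\<close> goes into the summand with index 0, which exists
    because \<open>m\<close> \<ge> 1.\<close>
  also have "\<dots> = (\<Sum>j<m. b' j + (if j = 0 then d else 0))"
    using m by (simp add: sum.distrib sum.delta)
  finally have "a = (\<Sum>j<m. b' j + (if j = 0 then d else 0))" .
  moreover have "\<forall>j<m. b' j + (if j = 0 then d else 0) \<in> expo_set (Q_sub (ideal_gen (xpow ` A)) P)"
    unfolding b'_def using b
    by (intro allI impI expo_set_Q_sub[OF P ideal_gen_is_ideal _ t] ideal_gen_base) auto
  ultimately show thesis
    using that by blast
qed

section \<open>From sums of exponents to the convex hull\<close>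

lemma real_expo_sum: "real_expo (\<Sum>j\<in>S. b j) = (\<Sum>j\<in>S. real_expo (b j))"
  by (simp add: real_expo_def vec_eq_iff lookup_sum)

lemma average_mem_convex_hull:
  fixes x :: "nat \<Rightarrow> 'a::real_vector"
  assumes "m \<ge> 1" and "\<And>j. j < m \<Longrightarrow> x j \<in> X"
  shows "(1 / real m) *\<^sub>R (\<Sum>j<m. x j) \<in> convex hull X"
  \<comment> \<open>Moving the scalar inside exhibits a convex combination with \<open>m\<close>
    equal weights.\<close>
  unfolding scaleR_sum_right using assms
  by (intro convex_sum) (auto simp: hull_inc)

theorem theorem5p4:
  fixes I :: "('v::{finite,linorder}, 'k::field) mpoly_ring set" and m :: nat
  assumes "monomial_ideal I" and "I \<noteq> {0}" and "I \<noteq> UNIV"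
    and "m \<ge> 1"
  shows "real_expo ` expo_set (symb_pow I m)
           \<subseteq> (\<lambda>a. real m *\<^sub>R a) ` symb_polyhedron I"
proof
  fix x
  assume "x \<in> real_expo ` expo_set (symb_pow I m)"
  then obtain a where x: "x = real_expo a" and a: "xpow a \<in> symb_pow I m"
    by (auto simp: expo_set_def)
  obtain A where I: "I = ideal_gen (xpow ` A)"
    using assms(1) unfolding monomial_ideal_def by blast
  have "(1 / real m) *\<^sub>R x \<in> convex hull (real_expo ` expo_set (Q_sub I P))" if "P \<in> maxAss I" for P
  proof -
    \<comment> \<open>A maximal associated prime is associated, so \<open>P\<close> is one of the
      primes over which \<open>symb_pow\<close> intersects.\<close>
    have "P \<in> Ass I" and P: "prime_ideal P"
      using that unfolding maxAss_def Ass_def by auto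
    then have "to_fract (xpow a) \<in> loc_ext (ideal_pow (ideal_gen (xpow ` A)) m) P"
      using a unfolding symb_pow_def I by blast
    then obtain b where "a = (\<Sum>j<m. b j)" and "\<forall>j<m. b j \<in> expo_set (Q_sub I P)"
      using expo_decomposition[OF P \<open>m \<ge> 1\<close>] unfolding I by metis
    then show ?thesis
      unfolding x by (simp only: real_expo_sum) (intro average_mem_convex_hull assms(4); blast)
  qed
  then have "(1 / real m) *\<^sub>R x \<in> symb_polyhedron I"
    unfolding symb_polyhedron_def by blast
  moreover have "x = real m *\<^sub>R ((1 / real m) *\<^sub>R x)"
    using assms(4) by simp
  ultimately show "x \<in> (\<lambda>a. real m *\<^sub>R a) ` symb_polyhedron I"
    by blast
qed

end
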